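(* Let $G=(V,E)$ be a finite simple graph without isolated vertices. Let $\vec x$ be an eigenvector of the signless 1-Laplacian $\Delta_1^+$ with eigenvalue $c_k$ (the $k$-th min-max eigenvalue), and let $r=\#\{j\in\{1,\dots,n\}: c_j=c_k\}$ be its multiplicity. Then the number $S(\vec x)$ of nodal domains of $\vec x$ satisfies $1\le S(\vec x)\le k+r-1$.
   Context: $V=\{1,\dots,n\}$, $d_i$ the degree of $i$. $\mathrm{Sgn}(t)=\{1\},[-1,1],\{-1\}$ for $t>0,t=0,t<0$. Signless 1-Laplacian: $(\Delta_1^+\vec x)_i=\{\sum_{j:\{i,j\}\in E}z_{ij}: z_{ij}\in\mathrm{Sgn}(x_i+x_j), z_{ij}=z_{ji}\}$; $(\lambda,\vec x)$ is an eigenpair if $\vec x\ne\vec 0$ and $\Delta_1^+\vec x\cap\lambda\,\mathrm{diag}(d_1,\dots,d_n)\mathrm{Sgn}(\vec x)\neq\emptyset$. Let $I^+(\vec x)=\sum_{\{i,j\}\in E}|x_i+x_j|$, $X=\{\vec x:\sum_i d_i|x_i|=1\}$, and $c_k=\inf\{\sup_{\vec x\in A}I^+(\vec x): A\subseteq X \text{ compact}, A=-A, \gamma(A)\ge k\}$, $k=1,\dots,n$, where $\gamma$ is the Krasnoselskii genus (the least $m$ such that there is a continuous odd map $A\to\mathbb{R}^m\setminus\{0\}$). The nodal domains of $\vec x$ are the vertex sets of the connected components of the subgraph induced by $\{i:x_i\neq0\}$. *)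

theory Defs
  imports "HOL-Analysis.Analysis" "HOL-Library.Extended_Nat"
begin

text \<open>The vertex set is the whole finite type \<open>'n\<close>, so that \<open>n = CARD('n)\<close>; a graph is given by its
  set of edges.\<close>

definition simple_graph :: "'n::finite set set \<Rightarrow> bool" where
  "simple_graph E \<longleftrightarrow> (\<forall>e\<in>E. card e = 2)"

definition degree :: "'n::finite set set \<Rightarrow> 'n \<Rightarrow> nat" where
  "degree E i = card {j. {i, j} \<in> E}"

definition no_isolated_vertices :: "'n::finite set set \<Rightarrow> bool" where
  "no_isolated_vertices E \<longleftrightarrow> (\<forall>i. \<exists>j. {i, j} \<in> E)"

definition Sgn :: "real \<Rightarrow> real set" where
  "Sgn t = (if t > 0 then {1} else if t = 0 then {-1..1} else {-1})"

definition Sgn_vec :: "real^'n \<Rightarrow> (real^'n) set" where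
  "Sgn_vec x = {v. \<forall>i. v $ i \<in> Sgn (x $ i)}"

text \<open>The numbers \<open>z i j\<close> are chosen once for all coordinates: the symmetry condition couples them.\<close>

definition signless_Laplacian :: "'n::finite set set \<Rightarrow> real^'n \<Rightarrow> (real^'n) set" where
  "signless_Laplacian E x =
     {\<chi> i. \<Sum>j | {i, j} \<in> E. z i j | z.
        \<forall>i j. {i, j} \<in> E \<longrightarrow> z i j \<in> Sgn (x $ i + x $ j) \<and> z i j = z j i}"

definition eigenpair :: "'n::finite set set \<Rightarrow> real \<Rightarrow> real^'n \<Rightarrow> bool" where
  "eigenpair E lam x \<longleftrightarrow>
     x \<noteq> 0 \<and>
     signless_Laplacian E x \<inter> (\<lambda>v. \<chi> i. lam * real (degree E i) * v $ i) ` Sgn_vec x \<noteq> {}"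

text \<open>For an edge \<open>e = {i, j}\<close> with \<open>i \<noteq> j\<close>, the inner sum is \<open>x $ i + x $ j\<close>.\<close>

definition I_plus :: "'n::finite set set \<Rightarrow> real^'n \<Rightarrow> real" where
  "I_plus E x = (\<Sum>e\<in>E. \<bar>\<Sum>i\<in>e. x $ i\<bar>)"

definition X_sphere :: "'n::finite set set \<Rightarrow> (real^'n) set" where
  "X_sphere E = {x. (\<Sum>i\<in>UNIV. real (degree E i) * \<bar>x $ i\<bar>) = 1}"

text \<open>Here \<open>Euclidean_space m\<close> is the library's model of real \<open>m\<close>-space for a natural number \<open>m\<close>:
  sequences vanishing from index \<open>m\<close> on. The genus is \<open>\<infinity>\<close> if there is no suitable \<open>m\<close>, and only
  the empty set has genus \<open>0\<close>.\<close>

definition genus :: "'a::real_normed_vector set \<Rightarrow> enat" where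
  "genus A = Inf {enat m | m. \<exists>f :: 'a \<Rightarrow> nat \<Rightarrow> real.
      continuous_map (top_of_set A) (subtopology (Euclidean_space m) (- {\<lambda>_. 0})) f \<and>
      (\<forall>x\<in>A. f (- x) = (\<lambda>i. - f x i))}"

text \<open>Without isolated vertices and for \<open>1 \<le> k \<le> CARD('n)\<close>, the infimum
  and the suprema are those of nonempty sets of reals, bounded below and above respectively.\<close>

definition minmax_value :: "'n::finite set set \<Rightarrow> nat \<Rightarrow> real" where
  "minmax_value E k =
     Inf {SUP x\<in>A. I_plus E x | A.
       A \<subseteq> X_sphere E \<and> compact A \<and> A = uminus ` A \<and> genus A \<ge> enat k}"

definition induced_adj :: "'n::finite set set \<Rightarrow> 'n set \<Rightarrow> 'n rel" where
  "induced_adj E D = {(i, j). i \<in> D \<and> j \<in> D \<and> {i, j} \<in> E}"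

definition components_of_induced :: "'n::finite set set \<Rightarrow> 'n set \<Rightarrow> 'n set set" where
  "components_of_induced E D = D // (induced_adj E D)\<^sup>*"

definition nodal_domains :: "'n::finite set set \<Rightarrow> real^'n \<Rightarrow> 'n set set" where
  "nodal_domains E x = components_of_induced E {i. x $ i \<noteq> 0}"

end

theory Submission
  imports "HOL-Homology.Homology" Defs
begin

text \<open>Let \<open>D\<^sub>1, \<dots>, D\<^sub>m\<close> be the nodal domains of \<open>x\<close>, let \<open>lam = c\<^sub>k\<close>, and let \<open>y\<close> be obtained from
  \<open>x\<close> by multiplying its entries on \<open>D\<^sub>l\<close> by \<open>a\<^sub>l\<close>. No edge joins two different domains, so the
  signs \<open>z i j\<close> that witness the eigenvalue equation for \<open>x\<close> give
  \<open>\<bar>y i + y j\<bar> = z i j * (\<bar>a i\<bar> * x i + \<bar>a j\<bar> * x j)\<close> on every edge, and summing over the edges yields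
  \<open>I\<^sup>+ y = lam * (\<Sum>i. d i * \<bar>y i\<bar>)\<close>. Hence \<open>I\<^sup>+ = lam\<close> on the intersection of \<open>X\<close> with an
  \<open>m\<close>-dimensional subspace. By Borsuk--Ulam its genus is at least \<open>m\<close>, so \<open>c\<^sub>m \<le> c\<^sub>k\<close>. As the \<open>c\<^sub>j\<close>
  increase, \<open>m \<ge> k + r\<close> would make \<open>c\<^sub>k = \<dots> = c\<^sub>m\<close> at least \<open>r + 1\<close> equal values.

  Borsuk--Ulam follows from the oddness of the degree of an odd self-map of a sphere. By induction and
  the library's theorem that the degrees of an odd map and of its restriction to an invariant equator
  have the same parity, it suffices to deform an odd map, through odd maps, so that it preserves the
  equator: the image of the equator under a smooth odd approximation misses a pair of antipodal
  points, and the rest of the sphere retracts oddly onto the equator orthogonal to them.\<close>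

subsection \<open>Odd maps of spheres\<close>

definition coord_space :: "(nat \<Rightarrow> 'a::euclidean_space) \<Rightarrow> nat \<Rightarrow> 'a set" where
  "coord_space b n = {v. \<forall>i. n \<le> i \<and> i < DIM('a) \<longrightarrow> v \<bullet> b i = 0}"

text \<open>The index is the dimension of the sphere, as for \<open>nsphere\<close>, so the ambient
  subspace has one coordinate more.\<close>

definition coord_sphere :: "(nat \<Rightarrow> 'a::euclidean_space) \<Rightarrow> nat \<Rightarrow> 'a set" where
  "coord_sphere b n = sphere 0 1 \<inter> coord_space b (Suc n)"

definition of_coords :: "(nat \<Rightarrow> 'a::euclidean_space) \<Rightarrow> (nat \<Rightarrow> real) \<Rightarrow> 'a" where
  "of_coords b x = (\<Sum>i<DIM('a). x i *\<^sub>R b i)"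

definition to_coords :: "(nat \<Rightarrow> 'a::euclidean_space) \<Rightarrow> 'a \<Rightarrow> nat \<Rightarrow> real" where
  "to_coords b v = (\<lambda>i. if i < DIM('a) then v \<bullet> b i else 0)"

text \<open>The library has the Brouwer degree only for maps of spheres of sequences.\<close>

definition sphere_degree :: "(nat \<Rightarrow> 'a::euclidean_space) \<Rightarrow> nat \<Rightarrow> ('a \<Rightarrow> 'a) \<Rightarrow> int" where
  "sphere_degree b n f = Brouwer_degree2 n (to_coords b \<circ> f \<circ> of_coords b)"

lemma subspace_coord_space: "subspace (coord_space b n)"
  by (auto simp: coord_space_def subspace_def inner_left_distrib)

lemma coord_space_mono: "m \<le> n \<Longrightarrow> coord_space b m \<subseteq> coord_space b n"
  by (auto simp: coord_space_def)

lemma coord_sphere_mono: "m \<le> n \<Longrightarrow> coord_sphere b m \<subseteq> coord_sphere b n"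
  using coord_space_mono [of "Suc m" "Suc n" b] by (auto simp: coord_sphere_def)

lemma coord_sphere_minus [simp]: "- v \<in> coord_sphere b n \<longleftrightarrow> v \<in> coord_sphere b n"
  by (auto simp: coord_sphere_def coord_space_def)

lemma compact_coord_sphere: "compact (coord_sphere b n)"
  unfolding coord_sphere_def
  by (intro compact_Int_closed compact_sphere closed_subspace subspace_coord_space)

lemma of_coords_minus: "of_coords b (\<lambda>i. - x i) = - of_coords b x"
  by (simp add: of_coords_def sum_negf)

lemma to_coords_minus: "to_coords b (- v) = (\<lambda>i. - to_coords b v i)"
  by (auto simp: to_coords_def)

context
  fixes b :: "nat \<Rightarrow> 'a::euclidean_space"
  assumes b: "bij_betw b {..<DIM('a)} Basis"
begin

lemma inner_enum_basis:
  assumes "i < DIM('a)" "j < DIM('a)" shows "b i \<bullet> b j = (if i = j then 1 else 0)"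
proof -
  have "b i \<in> Basis" "b j \<in> Basis" using b assms by (auto simp: bij_betw_def)
  moreover have "b i = b j \<longleftrightarrow> i = j" using b assms by (auto simp: bij_betw_def inj_on_def)
  ultimately show ?thesis by (simp add: inner_Basis)
qed

lemma norm_enum_basis: "i < DIM('a) \<Longrightarrow> norm (b i) = 1"
  by (simp add: norm_eq_sqrt_inner inner_enum_basis)

lemma enum_basis_in_coord_sphere: "n < DIM('a) \<Longrightarrow> b n \<in> coord_sphere b n"
  by (auto simp: coord_sphere_def coord_space_def norm_enum_basis inner_enum_basis)

lemma of_coords_inner: "i < DIM('a) \<Longrightarrow> of_coords b x \<bullet> b i = x i"
  by (simp add: of_coords_def inner_sum_left inner_enum_basis if_distrib cong: if_cong)

lemma of_to_coords: "of_coords b (to_coords b v) = v"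
proof -
  have "of_coords b (to_coords b v) = (\<Sum>i<DIM('a). (v \<bullet> b i) *\<^sub>R b i)"
    by (simp add: of_coords_def to_coords_def)
  also have "\<dots> = (\<Sum>e\<in>Basis. (v \<bullet> e) *\<^sub>R e)"
    by (rule sum.reindex_bij_betw [OF b])
  finally show ?thesis by (simp add: euclidean_representation)
qed

lemma norm_sq_coords: "(norm v)\<^sup>2 = (\<Sum>i<DIM('a). (v \<bullet> b i)\<^sup>2)"
proof -
  have "(norm v)\<^sup>2 = (\<Sum>e\<in>Basis. (v \<bullet> e)\<^sup>2)"
    unfolding power2_norm_eq_inner by (subst euclidean_inner) (simp add: power2_eq_square)
  then show ?thesis by (simp add: sum.reindex_bij_betw [OF b, of "\<lambda>e. (v \<bullet> e)\<^sup>2"])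
qed

lemma norm_sq_coord_space:
  assumes "v \<in> coord_space b (Suc n)" "n < DIM('a)"
  shows "(norm v)\<^sup>2 = (\<Sum>i\<le>n. (v \<bullet> b i)\<^sup>2)"
  unfolding norm_sq_coords
  by (rule sum.mono_neutral_right) (use assms in \<open>auto simp: coord_space_def\<close>)

lemma dim_coord_space:
  assumes "n \<le> DIM('a)" shows "dim (coord_space b n) = n"
proof -
  have img: "b ` {..<DIM('a)} = Basis" and inj: "inj_on b {..<DIM('a)}"
    using b by (auto simp: bij_betw_def)
  \<comment> \<open>The condition on indices is recast as one on basis vectors, the form that
    \<open>dim_substandard\<close> expects.\<close>
  have "coord_space b n = {v. \<forall>e\<in>Basis. e \<notin> b ` {..<n} \<longrightarrow> v \<bullet> e = 0}"
  proof -
    have *: "b i \<in> b ` {..<n} \<longleftrightarrow> i < n" if "i < DIM('a)" for i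
      using inj_on_image_mem_iff [OF inj, of i "{..<n}"] that assms by auto
    have "coord_space b n = {v. \<forall>i\<in>{..<DIM('a)}. \<not> i < n \<longrightarrow> v \<bullet> b i = 0}"
      by (auto simp: coord_space_def not_less)
    also have "\<dots> = {v. \<forall>i\<in>{..<DIM('a)}. b i \<notin> b ` {..<n} \<longrightarrow> v \<bullet> b i = 0}"
      using * by (intro Collect_cong ball_cong) (simp_all only: lessThan_iff)
    finally show ?thesis by (simp only: bij_betw_ball [OF b])
  qed
  moreover have "b ` {..<n} \<subseteq> Basis" using img assms by auto
  moreover have "card (b ` {..<n}) = n"
    using inj assms by (simp add: card_image inj_on_def)
  ultimately show ?thesis by (simp add: dim_substandard)
qed

lemma of_coords_in_coord_sphere:
  assumes "n < DIM('a)" "x \<in> topspace (nsphere n)" shows "of_coords b x \<in> coord_sphere b n"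
proof -
  have x: "(\<Sum>i\<le>n. (x i)\<^sup>2) = 1" "\<forall>i>n. x i = 0" using assms(2) by (auto simp: nsphere)
  have T: "of_coords b x \<in> coord_space b (Suc n)"
    using x(2) by (auto simp: coord_space_def of_coords_inner)
  have "(norm (of_coords b x))\<^sup>2 = 1"
    using x(1) assms(1) by (simp add: norm_sq_coord_space [OF T assms(1)] of_coords_inner)
  then have "norm (of_coords b x) = 1"
    by (simp add: abs_square_eq_1)
  then show ?thesis using T by (simp add: coord_sphere_def)
qed

lemma to_coords_in_nsphere:
  assumes "n < DIM('a)" "v \<in> coord_sphere b n" shows "to_coords b v \<in> topspace (nsphere n)"
proof -
  have T: "v \<in> coord_space b (Suc n)" and "norm v = 1" using assms by (auto simp: coord_sphere_def)
  then have "(\<Sum>i\<le>n. (v \<bullet> b i)\<^sup>2) = 1" using norm_sq_coord_space [OF T assms(1)] by simp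
  moreover have "(\<Sum>i\<le>n. (to_coords b v i)\<^sup>2) = (\<Sum>i\<le>n. (v \<bullet> b i)\<^sup>2)"
    using assms(1) by (intro sum.cong) (auto simp: to_coords_def)
  moreover have "\<forall>i>n. to_coords b v i = 0" using T by (auto simp: coord_space_def to_coords_def)
  ultimately show ?thesis by (simp add: nsphere)
qed

lemma to_of_coords:
  assumes "n < DIM('a)" "x \<in> topspace (nsphere n)" shows "to_coords b (of_coords b x) = x"
  using assms by (auto simp: to_coords_def of_coords_inner nsphere)

lemma continuous_map_of_coords:
  assumes "n < DIM('a)" shows "continuous_map (nsphere n) (top_of_set (coord_sphere b n)) (of_coords b)"
proof -
  have "continuous_map (nsphere n) euclidean (of_coords b)"
    unfolding of_coords_def
    by (simp add: nsphere euclidean_product_topology)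
       (intro continuous_intros continuous_on_product_coordinates [THEN continuous_on_subset] subset_UNIV)
  then show ?thesis
    using of_coords_in_coord_sphere [OF assms] by (auto simp: continuous_map_in_subtopology)
qed

lemma continuous_map_to_coords:
  assumes "n < DIM('a)" shows "continuous_map (top_of_set (coord_sphere b n)) (nsphere n) (to_coords b)"
proof -
  have "continuous_map (top_of_set (coord_sphere b n)) (powertop_real UNIV) (to_coords b)"
    by (auto simp: continuous_map_componentwise_UNIV to_coords_def intro!: continuous_intros)
  then show ?thesis
    using to_coords_in_nsphere [OF assms]
    by (auto simp: continuous_map_in_subtopology nsphere)
qed

lemma continuous_map_coords:
  assumes "n < DIM('a)" "continuous_on (coord_sphere b n) f" "f \<in> coord_sphere b n \<rightarrow> coord_sphere b n"
  shows "continuous_map (nsphere n) (nsphere n) (to_coords b \<circ> f \<circ> of_coords b)"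
proof -
  have "continuous_map (top_of_set (coord_sphere b n)) (top_of_set (coord_sphere b n)) f"
    using assms by auto
  then show ?thesis
    using assms(1) by (metis continuous_map_compose continuous_map_of_coords continuous_map_to_coords)
qed

lemma sphere_degree_homotopic:
  assumes "n < DIM('a)"
    "homotopic_with_canon (\<lambda>h. True) (coord_sphere b n) (coord_sphere b n) f g"
  shows "sphere_degree b n f = sphere_degree b n g"
proof -
  have 1: "homotopic_with (\<lambda>h. True) (nsphere n) (top_of_set (coord_sphere b n)) (f \<circ> of_coords b) (g \<circ> of_coords b)"
    by (rule homotopic_with_compose_continuous_map_right [OF assms(2)])
       (use assms continuous_map_of_coords in auto)
  have "homotopic_with (\<lambda>h. True) (nsphere n) (nsphere n) (to_coords b \<circ> (f \<circ> of_coords b)) (to_coords b \<circ> (g \<circ> of_coords b))"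
    by (rule homotopic_with_compose_continuous_map_left [OF 1])
       (use assms continuous_map_to_coords in auto)
  then show ?thesis
    unfolding sphere_degree_def by (simp add: Brouwer_degree2_homotopic comp_assoc)
qed

lemma sphere_degree_compose:
  assumes "n < DIM('a)"
    "continuous_on (coord_sphere b n) f" "f \<in> coord_sphere b n \<rightarrow> coord_sphere b n"
    "continuous_on (coord_sphere b n) g" "g \<in> coord_sphere b n \<rightarrow> coord_sphere b n"
  shows "sphere_degree b n (g \<circ> f) = sphere_degree b n g * sphere_degree b n f"
proof -
  have "to_coords b \<circ> (g \<circ> f) \<circ> of_coords b
      = (to_coords b \<circ> g \<circ> of_coords b) \<circ> (to_coords b \<circ> f \<circ> of_coords b)"
    by (auto simp: fun_eq_iff of_to_coords)
  then show ?thesis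
    unfolding sphere_degree_def
    by (simp add: Brouwer_degree2_compose continuous_map_coords assms)
qed

text \<open>The straight-line homotopy from \<open>f\<close> to \<open>q\<close> avoids the origin,
  so radial projection turns it into a homotopy within the sphere. This lets \<open>f\<close> be
  replaced by a map that is merely nonzero.\<close>

lemma sphere_degree_normalize:
  assumes n: "n < DIM('a)"
    and f: "continuous_on (coord_sphere b n) f" "f \<in> coord_sphere b n \<rightarrow> coord_sphere b n"
    and q: "continuous_on (coord_sphere b n) q" "q \<in> coord_sphere b n \<rightarrow> coord_space b (Suc n)"
    and seg: "\<And>x. x \<in> coord_sphere b n \<Longrightarrow> 0 \<notin> closed_segment (f x) (q x)"
  shows "sphere_degree b n f = sphere_degree b n (\<lambda>x. q x /\<^sub>R norm (q x))"
proof -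
  let ?S = "coord_sphere b n" and ?T = "coord_space b (Suc n)"
  let ?N = "\<lambda>y::'a. y /\<^sub>R norm y"
  have T: "subspace ?T" by (rule subspace_coord_space)
  have "homotopic_with_canon (\<lambda>z. True) ?S (?T - {0}) f q"
  proof (rule homotopic_with_linear [OF f(1) q(1)])
    fix x assume x: "x \<in> ?S"
    have "f x \<in> ?T" using x f(2) by (auto simp: coord_sphere_def)
    moreover have "q x \<in> ?T" using x q(2) by auto
    ultimately have "closed_segment (f x) (q x) \<subseteq> ?T"
      by (intro closed_segment_subset subspace_imp_convex T)
    with seg [OF x] show "closed_segment (f x) (q x) \<subseteq> ?T - {0}" by auto
  qed
  then have "homotopic_with_canon (\<lambda>z. True) ?S ?S (?N \<circ> f) (?N \<circ> q)"
  proof (rule homotopic_with_compose_continuous_map_left)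
    show "continuous_map (top_of_set (?T - {0})) (top_of_set ?S) ?N"
      by (auto simp: coord_sphere_def subspace_scale [OF T] intro!: continuous_intros)
  qed auto
  then have "sphere_degree b n (?N \<circ> f) = sphere_degree b n (?N \<circ> q)"
    by (rule sphere_degree_homotopic [OF n])
  moreover have "sphere_degree b n f = sphere_degree b n (?N \<circ> f)"
  proof (rule sphere_degree_homotopic [OF n], rule homotopic_with_equal)
    show "f x = (?N \<circ> f) x" if "x \<in> topspace (top_of_set ?S)" for x
      using that f(2) by (auto simp: coord_sphere_def Pi_iff)
  qed (use f in auto)
  ultimately show ?thesis by (simp add: comp_def)
qed

end

section \<open>Odd approximations and reflections\<close>

text \<open>Take a polynomial approximation \<open>p\<close> and its odd part. As \<open>f\<close>
  is odd, the error of the odd part is the mean of the errors of \<open>p\<close> at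
  \<open>x\<close> and \<open>- x\<close>, so the bound survives.\<close>

lemma odd_smooth_approximation:
  fixes f :: "'a::euclidean_space \<Rightarrow> 'b::euclidean_space"
  assumes "compact S" and sym: "\<And>x. x \<in> S \<Longrightarrow> - x \<in> S"
    and f: "continuous_on S f" "f \<in> S \<rightarrow> T" and odd: "\<And>x. x \<in> S \<Longrightarrow> f (- x) = - f x"
    and T: "subspace T" and "0 < e"
  obtains q where "\<And>U. q differentiable_on U" "q \<in> S \<rightarrow> T" "\<And>x. q (- x) = - q x"
    "\<And>x. x \<in> S \<Longrightarrow> norm (f x - q x) < e"
proof -
  obtain p where p: "polynomial_function p" "p ` S \<subseteq> T" "\<And>x. x \<in> S \<Longrightarrow> norm (f x - p x) < e"
    using Stone_Weierstrass_polynomial_function_subspace [OF assms(1) f(1) \<open>0 < e\<close> T] f(2) by blast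
  define q where "q x = (1/2) *\<^sub>R (p x - p (- x))" for x
  have "polynomial_function q"
    unfolding q_def
    using polynomial_function_compose [OF polynomial_function_minus [OF polynomial_function_id] p(1)]
    by (intro polynomial_function_cmul polynomial_function_diff p(1)) (simp add: comp_def)
  show thesis
  proof
    show "q differentiable_on U" for U
      by (rule differentiable_on_polynomial_function [OF \<open>polynomial_function q\<close>])
    show "q \<in> S \<rightarrow> T"
      using p(2) sym by (force simp: q_def intro!: subspace_scale [OF T] subspace_diff [OF T])
    show "q (- x) = - q x" for x
      by (simp add: q_def scaleR_right_diff_distrib)
    show "norm (f x - q x) < e" if x: "x \<in> S" for x
    proof -
      have eq: "f x - q x = (1/2) *\<^sub>R ((f x - p x) - (f (- x) - p (- x)))"
        by (simp add: q_def odd [OF x] algebra_simps flip: scaleR_add_left)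
      have "norm ((f x - p x) - (f (- x) - p (- x))) \<le> norm (f x - p x) + norm (f (- x) - p (- x))"
        by (rule norm_triangle_ineq4)
      then show ?thesis
        unfolding eq using p(3) [OF x] p(3) [OF sym [OF x]] by simp
    qed
  qed
qed

text \<open>This is the reflection in the hyperplane orthogonal to \<open>p - e\<close>; it moves a
  point by a multiple of \<open>p - e\<close> and so preserves every subspace containing
  \<open>p\<close> and \<open>e\<close>. It will carry a missed point to the pole.\<close>

lemma reflection_exchanging_unit_vectors:
  fixes p e :: "'a::real_inner"
  assumes "norm p = 1" "norm e = 1"
  obtains R where "linear R" "\<And>x. norm (R x) = norm x" "R p = e" "R e = p"
    "\<And>x. R (R x) = x" "\<And>T x. subspace T \<Longrightarrow> p \<in> T \<Longrightarrow> e \<in> T \<Longrightarrow> x \<in> T \<Longrightarrow> R x \<in> T"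
proof -
  define v where "v = p - e"
  \<comment> \<open>If \<open>p = e\<close>, division by zero makes \<open>R\<close> the identity, as desired.\<close>
  define R where "R x = x - (2 * (x \<bullet> v) / (v \<bullet> v)) *\<^sub>R v" for x
  have pp: "p \<bullet> p = 1" "e \<bullet> e = 1" using assms by (simp_all add: norm_eq_1)
  have vv: "v \<bullet> v = 2 * (p \<bullet> v)" "v \<bullet> v = - 2 * (e \<bullet> v)"
    using pp by (simp_all add: v_def inner_diff_left inner_diff_right inner_commute)
  have Rv: "R x \<bullet> v = - (x \<bullet> v)" for x
    by (cases "v = 0") (simp_all add: R_def inner_diff_left)
  show thesis
  proof
    show "linear R"
      by (rule linearI) (simp_all add: R_def inner_add_left add_divide_distrib algebra_simps)
    show RR: "R (R x) = x" for x
    proof -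
      have "R (R x) = R x - (2 * (R x \<bullet> v) / (v \<bullet> v)) *\<^sub>R v" by (simp only: R_def)
      also have "\<dots> = R x + (2 * (x \<bullet> v) / (v \<bullet> v)) *\<^sub>R v" by (simp add: Rv)
      finally show ?thesis by (simp add: R_def)
    qed
    show "norm (R x) = norm x" for x
    proof -
      \<comment> \<open>Only the right factor is expanded; \<open>Rv\<close> then takes care of the
        left one.\<close>
      have "R x \<bullet> R x = R x \<bullet> (x - (2 * (x \<bullet> v) / (v \<bullet> v)) *\<^sub>R v)" by (simp only: R_def)
      also have "\<dots> = R x \<bullet> x + (2 * (x \<bullet> v) / (v \<bullet> v)) * (x \<bullet> v)"
        by (simp add: inner_diff_right Rv)
      also have "\<dots> = x \<bullet> x" by (simp add: R_def inner_diff_left inner_diff_right inner_commute)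
      finally show ?thesis by (simp add: norm_eq)
    qed
    show "R p = e"
    proof (cases "v = 0")
      case False
      then have "2 * (p \<bullet> v) / (v \<bullet> v) = 1" unfolding vv(1) [symmetric] by simp
      then have "R p = p - v" by (simp only: R_def scaleR_one)
      then show ?thesis by (simp add: v_def)
    qed (use v_def R_def in auto)
    then show "R e = p" using RR by metis
    show "R x \<in> T" if "subspace T" "p \<in> T" "e \<in> T" "x \<in> T" for T x
      using that by (auto simp: R_def v_def intro!: subspace_diff subspace_scale)
  qed
qed

section \<open>Odd self-maps of spheres have odd degree\<close>

context
  fixes b :: "nat \<Rightarrow> 'a::euclidean_space"
  assumes b: "bij_betw b {..<DIM('a)} Basis"
begin

lemma coord_sphere_equator:
  "x \<in> coord_sphere b (Suc n) \<Longrightarrow> x \<bullet> b (Suc n) = 0 \<Longrightarrow> x \<in> coord_sphere b n"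
  by (auto simp: coord_sphere_def coord_space_def Suc_le_eq) (metis Suc_lessI)

lemma coord_sphere_equator_inner:
  "Suc n < DIM('a) \<Longrightarrow> x \<in> coord_sphere b n \<Longrightarrow> x \<bullet> b (Suc n) = 0"
  by (auto simp: coord_sphere_def coord_space_def)

lemma sphere_degree_odd_step:
  assumes n: "Suc n < DIM('a)"
    and f: "continuous_on (coord_sphere b (Suc n)) f"
      "f \<in> coord_sphere b (Suc n) \<rightarrow> coord_sphere b (Suc n)"
      "f \<in> coord_sphere b n \<rightarrow> coord_sphere b n"
    and odd: "\<And>x. x \<in> coord_sphere b (Suc n) \<Longrightarrow> f (- x) = - f x"
  shows "even (sphere_degree b (Suc n) f - sphere_degree b n f)"
proof -
  let ?F = "to_coords b \<circ> f \<circ> of_coords b"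
  have n': "n < DIM('a)" using n by simp
  have "even (Brouwer_degree2 (Suc n) ?F - Brouwer_degree2 (Suc n - Suc 0) ?F)"
  proof (rule Borsuk_odd_mapping_degree_step)
    show "continuous_map (nsphere (Suc n)) (nsphere (Suc n)) ?F"
      by (rule continuous_map_coords [OF b n f(1,2)])
    show "(?F \<circ> (\<lambda>x i. - x i)) u = ((\<lambda>x i. - x i) \<circ> ?F) u" if "u \<in> topspace (nsphere (Suc n))" for u
      using odd [OF of_coords_in_coord_sphere [OF b n that]]
      by (simp add: of_coords_minus to_coords_minus)
    show "?F \<in> topspace (nsphere (Suc n - Suc 0)) \<rightarrow> topspace (nsphere (Suc n - Suc 0))"
      using f(3) of_coords_in_coord_sphere [OF b n'] to_coords_in_nsphere [OF b n'] by fastforce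
  qed
  then show ?thesis by (simp add: sphere_degree_def)
qed

text \<open>The 0-sphere is a pair of antipodal points, on which an odd map is the identity or the
  swap. Either is its own inverse, so the degree is 1 or -1.\<close>

lemma odd_sphere_degree_0:
  assumes f: "f \<in> coord_sphere b 0 \<rightarrow> coord_sphere b 0"
    and odd: "\<And>x. x \<in> coord_sphere b 0 \<Longrightarrow> f (- x) = - f x"
  shows "odd (sphere_degree b 0 f)"
proof -
  let ?S = "coord_sphere b 0"
  have 0: "0 < DIM('a)" by simp
  have b0: "b 0 \<in> ?S" by (rule enum_basis_in_coord_sphere [OF b 0])
  have S: "?S = {b 0, - b 0}"
  proof -
    have "v = b 0 \<or> v = - b 0" if v: "v \<in> ?S" for v
    proof -
      have "v \<in> coord_space b (Suc 0)" "norm v = 1" using v by (auto simp: coord_sphere_def)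
      then have "(v \<bullet> b 0)\<^sup>2 = 1" using norm_sq_coord_space [OF b _ 0, of v] by simp
      moreover have "v = (v \<bullet> b 0) *\<^sub>R b 0"
      proof -
        have "v = of_coords b (to_coords b v)" by (simp add: of_to_coords [OF b])
        also have "\<dots> = (\<Sum>i<DIM('a). (v \<bullet> b i) *\<^sub>R b i)" by (simp add: of_coords_def to_coords_def)
        also have "\<dots> = (\<Sum>i\<in>{0}. (v \<bullet> b i) *\<^sub>R b i)"
          using \<open>v \<in> coord_space b (Suc 0)\<close>
          by (intro sum.mono_neutral_right) (auto simp: coord_space_def)
        finally show ?thesis by simp
      qed
      ultimately show ?thesis by (auto simp: power2_eq_1_iff)
    qed
    then show ?thesis using b0 by auto
  qed
  have cont: "continuous_on ?S f" unfolding S by (simp add: continuous_on_finite)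
  have ff: "f (f x) = x" if "x \<in> ?S" for x
  proof -
    have "f (b 0) = b 0 \<or> f (b 0) = - b 0" using f S by auto
    moreover have "f (- b 0) = - f (b 0)" using odd b0 by blast
    ultimately show ?thesis using that S by auto
  qed
  let ?F = "to_coords b \<circ> f \<circ> of_coords b"
  have "continuous_map (nsphere 0) (nsphere 0) ?F"
    by (rule continuous_map_coords [OF b 0 cont f])
  moreover have "?F (?F x) = x" if "x \<in> topspace (nsphere 0)" for x
    using ff of_coords_in_coord_sphere [OF b 0 that] to_of_coords [OF b 0 that]
    by (simp add: of_to_coords [OF b])
  ultimately have "homeomorphic_maps (nsphere 0) (nsphere 0) ?F ?F"
    by (simp add: homeomorphic_maps_def)
  then have "\<bar>Brouwer_degree2 0 ?F\<bar> = 1"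
    by (rule Brouwer_degree2_homeomorphic_maps)
  then show ?thesis unfolding sphere_degree_def by (metis dvd_abs_iff odd_one)
qed

text \<open>The chain is: \<open>h\<close>, a smooth odd map homotopic to \<open>f\<close>;
  \<open>k\<close>, which is \<open>h\<close> followed by a reflection taking a point missed by the
  equator's image to the pole \<open>e\<close>; \<open>g\<close>, a deformation of \<open>k\<close>
  that preserves the equator. The induction hypothesis applies to \<open>g\<close> on the
  equator.\<close>

lemma odd_sphere_degree_Suc:
  assumes n: "Suc n < DIM('a)"
    and IH: "\<And>g. \<lbrakk>continuous_on (coord_sphere b n) g; g \<in> coord_sphere b n \<rightarrow> coord_sphere b n;
        \<And>x. x \<in> coord_sphere b n \<Longrightarrow> g (- x) = - g x\<rbrakk> \<Longrightarrow> odd (sphere_degree b n g)"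
    and f: "continuous_on (coord_sphere b (Suc n)) f"
      "f \<in> coord_sphere b (Suc n) \<rightarrow> coord_sphere b (Suc n)"
    and f_odd: "\<And>x. x \<in> coord_sphere b (Suc n) \<Longrightarrow> f (- x) = - f x"
  shows "odd (sphere_degree b (Suc n) f)"
proof -
  let ?S = "coord_sphere b (Suc n)" and ?S' = "coord_sphere b n" and ?T = "coord_space b (Suc (Suc n))"
  define e where "e = b (Suc n)"
  have T: "subspace ?T" by (rule subspace_coord_space)
  have S_T: "x \<in> ?T" "norm x = 1" if "x \<in> ?S" for x using that by (auto simp: coord_sphere_def)
  have S_I: "x \<in> ?S" if "x \<in> ?T" "norm x = 1" for x using that by (auto simp: coord_sphere_def)
  have S'_S: "?S' \<subseteq> ?S" by (rule coord_sphere_mono) simp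
  have e: "e \<in> ?S" unfolding e_def by (rule enum_basis_in_coord_sphere [OF b n])
  obtain q where q: "\<And>U. q differentiable_on U" "q \<in> ?S \<rightarrow> ?T" "\<And>x. q (- x) = - q x"
    "\<And>x. x \<in> ?S \<Longrightarrow> norm (f x - q x) < 1"
  proof (rule odd_smooth_approximation [OF compact_coord_sphere _ f(1) _ f_odd T])
    show "f \<in> ?S \<rightarrow> ?T" using f(2) S_T by auto
    show "(0::real) < 1" by simp
  qed auto
  \<comment> \<open>The tolerance 1 equals the norm of \<open>f x\<close>, so the segment is too
    short to reach the origin.\<close>
  have seg1: "0 \<notin> closed_segment (f x) (q x)" if x: "x \<in> ?S" for x
  proof
    assume "0 \<in> closed_segment (f x) (q x)"
    then have "norm (0 - f x) \<le> norm (f x - q x)"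
      using segment_bound1 [of 0 "f x" "q x"] by (simp add: norm_minus_commute)
    moreover have "norm (f x) = 1" using f(2) x S_T by auto
    ultimately show False using q(4) [OF x] by simp
  qed
  have q0: "q x \<noteq> 0" if "x \<in> ?S" for x using seg1 [OF that] by auto
  have q_cont: "continuous_on U q" for U using q(1) by (rule differentiable_imp_continuous_on)
  define h where "h x = q x /\<^sub>R norm (q x)" for x
  have deg_h: "sphere_degree b (Suc n) f = sphere_degree b (Suc n) h"
    unfolding h_def by (rule sphere_degree_normalize [OF b n f q_cont q(2) seg1])
  have h: "h \<in> ?S \<rightarrow> ?S" using q(2) q0 by (auto simp: h_def intro!: S_I subspace_scale [OF T])
  have h_cont: "continuous_on ?S h" unfolding h_def using q0 by (intro continuous_intros q_cont) auto
  have h_odd: "h (- x) = - h x" for x by (simp add: h_def q(3))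
  \<comment> \<open>A differentiable image of the equator cannot fill a sphere of higher dimension;
    this is what the smoothness of \<open>q\<close> is for.\<close>
  obtain p where p: "p \<in> ?S" "p \<notin> h ` ?S'"
  proof -
    have "h ` (sphere 0 1 \<inter> coord_space b (Suc n)) \<noteq> sphere 0 1 \<inter> ?T"
    proof (rule spheremap_lemma1 [OF subspace_coord_space T])
      show "dim (coord_space b (Suc n)) < dim ?T" using n by (simp add: dim_coord_space [OF b])
      show "coord_space b (Suc n) \<subseteq> ?T" by (rule coord_space_mono) simp
      have "(norm \<circ> q) differentiable_on ?S'"
        unfolding comp_def
        by (rule differentiable_on_compose [OF q(1)], rule differentiable_on_norm) (use q0 S'_S in force)
      then have "h differentiable_on ?S'"
        unfolding h_def comp_def using q0 S'_S by (intro derivative_intros q(1)) auto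
      then show "h differentiable_on sphere 0 1 \<inter> coord_space b (Suc n)"
        by (simp add: coord_sphere_def)
    qed
    then have "h ` ?S' \<noteq> ?S" by (simp add: coord_sphere_def)
    moreover have "h ` ?S' \<subseteq> ?S" using h S'_S by auto
    ultimately show thesis using that by blast
  qed
  obtain R where R: "linear R" "\<And>x. norm (R x) = norm x" "R p = e" "R e = p" "\<And>x. R (R x) = x"
    "\<And>x. x \<in> ?T \<Longrightarrow> R x \<in> ?T"
    using reflection_exchanging_unit_vectors [of p e] S_T p(1) e T by metis
  have RS: "R \<in> ?S \<rightarrow> ?S" using R(2,6) S_T S_I by auto
  have R_cont: "continuous_on U R" for U using R(1) by (simp add: linear_continuous_on linear_linear)
  define k where "k = R \<circ> h"
  have k: "k \<in> ?S \<rightarrow> ?S" using h RS by (auto simp: k_def)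
  have k_cont: "continuous_on ?S k" unfolding k_def by (intro continuous_on_compose h_cont R_cont)
  have k_odd: "k (- x) = - k x" for x by (simp add: k_def h_odd linear_neg [OF R(1)])
  \<comment> \<open>Avoiding \<open>e\<close> at both \<open>x\<close> and \<open>- x\<close> means,
    by oddness, avoiding both poles at \<open>x\<close>.\<close>
  have k_neq: "k x \<noteq> e" "k x \<noteq> - e" if "x \<in> ?S'" for x
  proof -
    have "k y \<noteq> e" if "y \<in> ?S'" for y
    proof
      assume "k y = e"
      then have "h y = p" using R(4,5) unfolding k_def comp_def by metis
      then show False using p(2) that by blast
    qed
    from this [of x] this [of "- x"] show "k x \<noteq> e" "k x \<noteq> - e"
      using that by (auto simp: k_odd)
  qed
  \<comment> \<open>An odd product has odd factors, so the parity of the degree of \<open>k\<close>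
    will settle that of \<open>h\<close>.\<close>
  have deg_k: "sphere_degree b (Suc n) k = sphere_degree b (Suc n) R * sphere_degree b (Suc n) h"
    unfolding k_def by (rule sphere_degree_compose [OF b n h_cont h R_cont RS])
  \<comment> \<open>The even factor \<open>1 - \<bar>x \<bullet> e\<bar>\<close> removes the \<open>e\<close>-component completely on the equator only, where
    \<open>k\<close> avoids the poles; so the segment from \<open>k x\<close> to \<open>w x\<close> never meets the origin.\<close>
  define w where "w x = k x - ((1 - \<bar>x \<bullet> e\<bar>) * (k x \<bullet> e)) *\<^sub>R e" for x
  have w: "w \<in> ?S \<rightarrow> ?T"
    using k e S_T(1) by (force simp: w_def intro!: subspace_diff [OF T] subspace_scale [OF T])
  have w_cont: "continuous_on ?S w" unfolding w_def by (intro continuous_intros k_cont)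
  have w_odd: "w (- x) = - w x" for x by (simp add: w_def k_odd)
  have seg2: "0 \<notin> closed_segment (k x) (w x)" if x: "x \<in> ?S" for x
  proof
    assume "0 \<in> closed_segment (k x) (w x)"
    then obtain u where u: "0 \<le> u" "u \<le> 1" "0 = (1 - u) *\<^sub>R k x + u *\<^sub>R w x"
      by (auto simp: in_segment)
    \<comment> \<open>A zero on the segment makes \<open>k x\<close> a multiple of \<open>e\<close>,
      hence a pole. Comparing \<open>e\<close>-components forces
      \<open>u * (1 - \<bar>x \<bullet> e\<bar>) = 1\<close>, so \<open>x\<close> lies on the
      equator, where \<open>k\<close> takes no pole as value.\<close>
    define c where "c = u * (1 - \<bar>x \<bullet> e\<bar>) * (k x \<bullet> e)"
    have kc: "k x = c *\<^sub>R e" using u(3) by (simp add: w_def c_def algebra_simps)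
    have "norm (k x) = 1" using k x S_T by auto
    then have c1: "\<bar>c\<bar> = 1" using S_T(2) [OF e] by (simp add: kc)
    have "k x \<bullet> e = c" using S_T(2) [OF e] by (simp add: kc norm_eq_1)
    then have "c = u * (1 - \<bar>x \<bullet> e\<bar>) * c" by (simp add: c_def)
    then have 1: "u * (1 - \<bar>x \<bullet> e\<bar>) = 1" using c1 by auto
    have "\<bar>x \<bullet> e\<bar> \<le> 1" using Cauchy_Schwarz_ineq2 [of x e] S_T(2) x e by simp
    then have "u * (1 - \<bar>x \<bullet> e\<bar>) \<le> 1 - \<bar>x \<bullet> e\<bar>" using u(2) by (simp add: mult_left_le_one_le u(1))
    then have "x \<bullet> e = 0" using 1 by simp
    then have "x \<in> ?S'" using coord_sphere_equator x by (simp add: e_def)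
    then show False using k_neq c1 kc by (auto simp: abs_if split: if_splits)
  qed
  have w0: "w x \<noteq> 0" if "x \<in> ?S" for x using seg2 [OF that] by auto
  define g where "g x = w x /\<^sub>R norm (w x)" for x
  have deg_g: "sphere_degree b (Suc n) k = sphere_degree b (Suc n) g"
    unfolding g_def by (rule sphere_degree_normalize [OF b n k_cont k w_cont w seg2])
  have g: "g \<in> ?S \<rightarrow> ?S" using w w0 by (auto simp: g_def intro!: S_I subspace_scale [OF T])
  have g_cont: "continuous_on ?S g" unfolding g_def using w0 by (intro continuous_intros w_cont) auto
  have g_odd: "g (- x) = - g x" for x by (simp add: g_def w_odd)
  have g': "g \<in> ?S' \<rightarrow> ?S'"
  proof
    fix x assume x: "x \<in> ?S'"
    then have "x \<bullet> e = 0" using coord_sphere_equator_inner n by (simp add: e_def)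
    then have "w x \<bullet> e = 0" using S_T(2) [OF e] by (simp add: w_def inner_diff_left norm_eq_1)
    then have "g x \<bullet> e = 0" by (simp add: g_def)
    then show "g x \<in> ?S'" using coord_sphere_equator g x S'_S by (auto simp: e_def)
  qed
  have "odd (sphere_degree b n g)"
    using IH continuous_on_subset [OF g_cont S'_S] g' g_odd by blast
  moreover have "even (sphere_degree b (Suc n) g - sphere_degree b n g)"
    by (rule sphere_degree_odd_step [OF n g_cont g g' g_odd])
  ultimately have "odd (sphere_degree b (Suc n) g)" by simp
  then show ?thesis using deg_h deg_k deg_g by simp
qed

theorem odd_sphere_degree:
  assumes "n < DIM('a)" "continuous_on (coord_sphere b n) f" "f \<in> coord_sphere b n \<rightarrow> coord_sphere b n"
    and "\<And>x. x \<in> coord_sphere b n \<Longrightarrow> f (- x) = - f x"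
  shows "odd (sphere_degree b n f)"
  using assms
proof (induction n arbitrary: f)
  case 0
  then show ?case by (intro odd_sphere_degree_0)
next
  case (Suc n)
  show ?case
    by (rule odd_sphere_degree_Suc [OF Suc.prems(1) Suc.IH Suc.prems(2-4)]) (use Suc.prems(1) in auto)
qed

text \<open>A map that misses a point has degree 0, which is even.\<close>

lemma odd_map_coord_sphere_surj:
  assumes n: "n < DIM('a)" and f: "continuous_on (coord_sphere b n) f"
    "f \<in> coord_sphere b n \<rightarrow> coord_sphere b n"
    and odd: "\<And>x. x \<in> coord_sphere b n \<Longrightarrow> f (- x) = - f x"
  shows "f ` coord_sphere b n = coord_sphere b n"
proof (rule ccontr)
  assume "f ` coord_sphere b n \<noteq> coord_sphere b n"
  then obtain p where p: "p \<in> coord_sphere b n" "p \<notin> f ` coord_sphere b n" using f(2) by auto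
  let ?F = "to_coords b \<circ> f \<circ> of_coords b"
  have "to_coords b p \<notin> ?F ` topspace (nsphere n)"
  proof
    assume "to_coords b p \<in> ?F ` topspace (nsphere n)"
    then obtain x where x: "x \<in> topspace (nsphere n)" "to_coords b p = to_coords b (f (of_coords b x))"
      by auto
    then have "p = f (of_coords b x)" by (metis of_to_coords [OF b])
    then show False using p(2) of_coords_in_coord_sphere [OF b n x(1)] by blast
  qed
  moreover have "to_coords b p \<in> topspace (nsphere n)" by (rule to_coords_in_nsphere [OF b n p(1)])
  ultimately have "?F ` topspace (nsphere n) \<noteq> topspace (nsphere n)" by blast
  then have "sphere_degree b n f = 0"
    unfolding sphere_degree_def
    by (rule Brouwer_degree2_nonsurjective [OF continuous_map_coords [OF b n f]])
  then show False using odd_sphere_degree [OF n f odd] by simp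
qed

end

section \<open>Borsuk--Ulam as a lower bound for the genus\<close>

text \<open>If \<open>f\<close> maps \<open>A\<close> oddly to nonzero vectors of
  \<open>m\<close>-space with \<open>m < dim T\<close>, then \<open>f\<close> after
  \<open>L\<close>, normalized, becomes an odd self-map of the unit sphere of \<open>T\<close> with
  values in a proper subsphere, contradicting surjectivity.\<close>

theorem genus_ge_dim:
  fixes L :: "'a::euclidean_space \<Rightarrow> 'b::real_normed_vector"
  assumes T: "subspace T"
    and L: "continuous_on (sphere 0 1 \<inter> T) L" "L \<in> sphere 0 1 \<inter> T \<rightarrow> A"
    and L_odd: "\<And>u. u \<in> sphere 0 1 \<inter> T \<Longrightarrow> L (- u) = - L u"
  shows "enat (dim T) \<le> genus A"
  unfolding genus_def
proof (rule Inf_greatest, clarify)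
  fix m and f :: "'b \<Rightarrow> nat \<Rightarrow> real"
  assume f: "continuous_map (top_of_set A) (subtopology (Euclidean_space m) (- {\<lambda>_. 0})) f"
    and f_odd: "\<forall>x\<in>A. f (- x) = (\<lambda>i. - f x i)"
  have f_cont: "continuous_on A (\<lambda>x. f x i)" for i
    using f by (auto simp: Euclidean_space_def continuous_map_in_subtopology continuous_map_componentwise_UNIV)
  have f_im: "\<forall>i\<ge>m. f x i = 0" "f x \<noteq> (\<lambda>_. 0)" if "x \<in> A" for x
    using f that by (auto simp: Euclidean_space_def continuous_map_in_subtopology Pi_iff)
  have "dim T \<le> m"
  proof (rule ccontr)
    assume "\<not> dim T \<le> m"
    \<comment> \<open>Thus \<open>d\<close> is the dimension of the unit sphere of \<open>T\<close>,
      which the isometry \<open>g\<close> below identifies with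
      \<open>coord_sphere b d\<close>.\<close>
    then obtain d where d: "dim T = Suc d" "m \<le> d" by (metis Suc_le_D less_eq_Suc_le not_le Suc_le_mono)
    have dn: "d < DIM('a)" using dim_subset_UNIV [of T] d by simp
    obtain b :: "nat \<Rightarrow> 'a" where b: "bij_betw b {..<DIM('a)} Basis"
      using ex_bij_betw_nat_finite [of "Basis :: 'a set"] by (auto simp: atLeast0LessThan)
    let ?S = "coord_sphere b d"
    have "dim (coord_space b (Suc d)) = dim T" using d dn by (simp add: dim_coord_space [OF b])
    then obtain g where g: "linear g" "g ` coord_space b (Suc d) = T"
      "\<And>x. x \<in> coord_space b (Suc d) \<Longrightarrow> norm (g x) = norm x"
      using isometries_subspaces [OF subspace_coord_space T] by metis
    have g_im: "g v \<in> sphere 0 1 \<inter> T" if "v \<in> ?S" for v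
      using that g(2,3) by (auto simp: coord_sphere_def)
    have g_cont: "continuous_on U g" for U using g(1) by (simp add: linear_continuous_on linear_linear)
    define w where "w v = of_coords b (f (L (g v)))" for v
    have LA: "L (g v) \<in> A" if "v \<in> ?S" for v using L(2) g_im [OF that] by blast
    have w_odd: "w (- v) = - w v" if "v \<in> ?S" for v
      using f_odd LA [OF that] L_odd [OF g_im [OF that]]
      by (simp add: w_def linear_neg [OF g(1)] flip: of_coords_minus)
    have w_space: "w v \<in> coord_space b d" if "v \<in> ?S" for v
      using f_im(1) [OF LA [OF that]] d(2) by (simp add: w_def coord_space_def of_coords_inner [OF b])
    have w0: "w v \<noteq> 0" if "v \<in> ?S" for v
    proof
      assume "w v = 0"
      \<comment> \<open>The entries below \<open>m\<close> are coordinates of \<open>w v\<close>, as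
        \<open>m \<le> d < DIM('a)\<close>; the others vanish in
        \<open>Euclidean_space m\<close>.\<close>
      have "f (L (g v)) i = 0" for i
      proof (cases "i < m")
        case True
        then have "f (L (g v)) i = w v \<bullet> b i"
          using d dn by (simp add: w_def of_coords_inner [OF b])
        then show ?thesis using \<open>w v = 0\<close> by simp
      qed (use f_im(1) [OF LA [OF that]] in auto)
      then show False using f_im(2) [OF LA [OF that]] by auto
    qed
    have w_cont: "continuous_on ?S w"
      unfolding w_def of_coords_def
      by (intro continuous_intros continuous_on_compose2 [OF f_cont]
          continuous_on_compose2 [OF L(1)] g_cont) (use g_im LA in auto)
    define h where "h v = w v /\<^sub>R norm (w v)" for v
    have h_space: "h v \<in> coord_space b d" if "v \<in> ?S" for v
      using w_space [OF that] by (simp add: h_def subspace_scale subspace_coord_space)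
    have "h ` ?S = ?S"
    proof (rule odd_map_coord_sphere_surj [OF b dn])
      show "continuous_on ?S h" unfolding h_def using w0 by (intro continuous_intros w_cont) auto
      show "h (- v) = - h v" if "v \<in> ?S" for v using w_odd [OF that] by (simp add: h_def)
      have "norm (h v) = 1" if "v \<in> ?S" for v using w0 [OF that] by (simp add: h_def)
      then show "h \<in> ?S \<rightarrow> ?S"
        using h_space coord_space_mono [of d "Suc d" b] by (auto simp: coord_sphere_def)
    qed
    \<comment> \<open>The pole \<open>b d\<close> would be a value of \<open>h\<close>, but the
      values of \<open>h\<close> have \<open>d\<close>-th coordinate 0.\<close>
    then obtain v where "v \<in> ?S" "b d = h v" using enum_basis_in_coord_sphere [OF b dn] by (metis imageE)
    then have "b d \<in> coord_space b d" using h_space by simp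
    then have "b d \<bullet> b d = 0" using dn by (simp add: coord_space_def)
    then show False using dn by (simp add: inner_enum_basis [OF b])
  qed
  then show "enat (dim T) \<le> enat m" by simp
qed

text \<open>This keeps the empty set, over which a real supremum says nothing, out of the min-max
  for \<open>k \<ge> 1\<close>.\<close>

lemma genus_empty: "genus ({} :: 'a::real_normed_vector set) = 0"
proof -
  have "enat 0 \<in> {enat m | m. \<exists>f :: 'a \<Rightarrow> nat \<Rightarrow> real.
      continuous_map (top_of_set {}) (subtopology (Euclidean_space m) (- {\<lambda>_. 0})) f \<and>
      (\<forall>x\<in>{}. f (- x) = (\<lambda>i. - f x i))}"
    by (auto simp: continuous_map_def)
  then have "genus ({} :: 'a set) \<le> enat 0" unfolding genus_def by (rule Inf_lower)
  then show ?thesis by (metis le_zero_eq zero_enat_def)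
qed

subsection \<open>The min-max values\<close>

lemma degree_pos:
  assumes "no_isolated_vertices E" shows "0 < degree E i"
proof -
  obtain j where "{i, j} \<in> E" using assms by (auto simp: no_isolated_vertices_def)
  then show ?thesis by (auto simp: degree_def card_gt_0_iff)
qed

definition degree_norm :: "'n::finite set set \<Rightarrow> real^'n \<Rightarrow> real" where
  "degree_norm E x = (\<Sum>i\<in>UNIV. real (degree E i) * \<bar>x $ i\<bar>)"

lemma X_sphere_degree_norm: "X_sphere E = {x. degree_norm E x = 1}"
  by (simp add: X_sphere_def degree_norm_def)

lemma degree_norm_pos:
  assumes "no_isolated_vertices E" "x \<noteq> 0" shows "0 < degree_norm E x"
proof -
  obtain i where "x $ i \<noteq> 0" using assms(2) by (auto simp: vec_eq_iff)
  then show ?thesis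
    unfolding degree_norm_def using degree_pos [OF assms(1), of i]
    by (intro sum_pos2 [of UNIV i]) auto
qed

lemma degree_norm_minus [simp]: "degree_norm E (- x) = degree_norm E x"
  by (simp add: degree_norm_def)

lemma degree_norm_scaleR: "degree_norm E (c *\<^sub>R x) = \<bar>c\<bar> * degree_norm E x"
  by (simp add: degree_norm_def sum_distrib_left abs_mult mult_ac)

lemma continuous_on_degree_norm [continuous_intros]:
  "continuous_on S f \<Longrightarrow> continuous_on S (\<lambda>u. degree_norm E (f u))"
  unfolding degree_norm_def by (intro continuous_intros)

lemma continuous_on_I_plus: "continuous_on S (I_plus E)"
  unfolding I_plus_def by (intro continuous_intros)

definition admissible :: "'n::finite set set \<Rightarrow> nat \<Rightarrow> (real^'n) set \<Rightarrow> bool" where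
  "admissible E k A \<longleftrightarrow> A \<subseteq> X_sphere E \<and> compact A \<and> A = uminus ` A \<and> enat k \<le> genus A"

lemma admissibleD:
  assumes "admissible E k A" shows "A \<subseteq> X_sphere E" "compact A" "enat k \<le> genus A"
  using assms unfolding admissible_def by blast+

lemma admissible_mono: "admissible E k A \<Longrightarrow> j \<le> k \<Longrightarrow> admissible E j A"
  unfolding admissible_def by (meson enat_ord_simps(1) order_trans)

lemma minmax_value_admissible:
  "minmax_value E k = (INF A \<in> Collect (admissible E k). SUP x\<in>A. I_plus E x)"
  unfolding minmax_value_def admissible_def by (rule arg_cong [where f = Inf]) auto

lemma admissible_nonempty: "admissible E k A \<Longrightarrow> 1 \<le> k \<Longrightarrow> A \<noteq> {}"
  using admissibleD(3) [of E k A] by (auto simp: genus_empty enat_0_iff)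

text \<open>Nonemptiness and compactness of \<open>A\<close> make each supremum a genuine one, so it
  inherits the bound 0 from \<open>I_plus\<close>.\<close>

lemma bdd_below_minmax:
  assumes "1 \<le> k" shows "bdd_below ((\<lambda>A. SUP x\<in>A. I_plus E x) ` Collect (admissible E k))"
proof (rule bdd_belowI2)
  fix A assume "A \<in> Collect (admissible E k)"
  then have A: "admissible E k A" by simp
  then obtain x where x: "x \<in> A" using admissible_nonempty assms by blast
  have "compact (I_plus E ` A)"
    using A by (intro compact_continuous_image continuous_on_I_plus admissibleD)
  then have "bdd_above (I_plus E ` A)" by (rule bounded_imp_bdd_above [OF compact_imp_bounded])
  moreover have "0 \<le> I_plus E x" by (simp add: I_plus_def sum_nonneg)
  ultimately show "0 \<le> (SUP x\<in>A. I_plus E x)" using x by (meson cSUP_upper2)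
qed

lemma minmax_value_le:
  assumes "admissible E k A" "1 \<le> k" "\<And>x. x \<in> A \<Longrightarrow> I_plus E x \<le> t"
  shows "minmax_value E k \<le> t"
proof -
  have "minmax_value E k \<le> (SUP x\<in>A. I_plus E x)"
    unfolding minmax_value_admissible
    by (rule cINF_lower [OF bdd_below_minmax [OF assms(2)]]) (simp add: assms(1))
  also have "\<dots> \<le> t" by (rule cSUP_least [OF admissible_nonempty [OF assms(1,2)] assms(3)])
  finally show ?thesis .
qed

text \<open>The source of all competitors: the unit sphere of \<open>T\<close> is mapped oddly by
  \<open>H\<close> and projected radially to \<open>X_sphere E\<close>; the composite is odd, so
  \<open>genus_ge_dim\<close> applies.\<close>

lemma admissible_image:
  fixes H :: "real^'n \<Rightarrow> real^'n"
  assumes E: "no_isolated_vertices E" and T: "subspace T"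
    and H: "continuous_on (sphere 0 1 \<inter> T) H" "\<And>u. u \<in> sphere 0 1 \<inter> T \<Longrightarrow> H u \<noteq> 0"
      "\<And>u. H (- u) = - H u"
  shows "admissible E (dim T) ((\<lambda>u. H u /\<^sub>R degree_norm E (H u)) ` (sphere 0 1 \<inter> T))"
proof -
  let ?S = "sphere 0 1 \<inter> T" and ?L = "\<lambda>u. H u /\<^sub>R degree_norm E (H u)"
  have pos: "0 < degree_norm E (H u)" if "u \<in> ?S" for u by (rule degree_norm_pos [OF E H(2) [OF that]])
  have cont: "continuous_on ?S ?L" using pos by (intro continuous_intros H(1)) force
  have odd: "?L (- u) = - ?L u" for u by (simp add: H(3))
  have sym: "- u \<in> ?S" if "u \<in> ?S" for u using that subspace_neg [OF T] by auto
  have "degree_norm E (?L u) = 1" if "u \<in> ?S" for u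
    using pos [OF that] by (simp add: degree_norm_scaleR)
  then have "?L ` ?S \<subseteq> X_sphere E" by (auto simp: X_sphere_degree_norm)
  moreover have "compact (?L ` ?S)"
    by (intro compact_continuous_image cont compact_Int_closed compact_sphere closed_subspace T)
  moreover have "uminus ` ?L ` ?S = ?L ` ?S"
  proof -
    have "u \<in> uminus ` ?S" if "u \<in> ?S" for u
      using image_eqI [of u uminus "- u" ?S] sym [OF that] by simp
    then have S: "uminus ` ?S = ?S" using sym by blast
    have "uminus ` ?L ` ?S = ?L ` uminus ` ?S" by (simp only: image_image odd)
    then show ?thesis by (simp only: S)
  qed
  moreover have "enat (dim T) \<le> genus (?L ` ?S)"
    by (rule genus_ge_dim [OF T cont _ odd]) blast
  ultimately show ?thesis unfolding admissible_def by metis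
qed

text \<open>A larger index leaves fewer competitors. The bound by \<open>CARD('n)\<close> ensures
  that some remain, since a real infimum over the empty set would not be infinite.\<close>

lemma minmax_value_mono:
  fixes E :: "'n::finite set set"
  assumes E: "no_isolated_vertices E" and "1 \<le> j" "j \<le> k" "k \<le> CARD('n)"
  shows "minmax_value E j \<le> minmax_value E k"
  unfolding minmax_value_admissible
proof (rule cINF_superset_mono [OF _ bdd_below_minmax [OF \<open>1 \<le> j\<close>]])
  \<comment> \<open>With \<open>H\<close> the identity and \<open>T\<close> the whole space, the
    competitor is all of \<open>X_sphere E\<close>.\<close>
  have "admissible E (dim (UNIV :: (real^'n) set))
      ((\<lambda>u. u /\<^sub>R degree_norm E u) ` (sphere 0 1 \<inter> UNIV))"
    by (rule admissible_image [OF E]) (auto intro: continuous_intros)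
  then show "Collect (admissible E k) \<noteq> {}"
    using admissible_mono \<open>k \<le> CARD('n)\<close> by fastforce
  show "Collect (admissible E k) \<subseteq> Collect (admissible E j)"
    using admissible_mono \<open>j \<le> k\<close> by blast
qed simp

subsection \<open>Eigenvectors and nodal domains\<close>

text \<open>Double counting: over each edge lie exactly two ordered pairs, as its ends are
  distinct.\<close>

lemma sum_edges:
  assumes "simple_graph E" and G: "\<And>i j. {i, j} \<in> E \<Longrightarrow> G {i, j} = F i j + F j i"
  shows "(\<Sum>e\<in>E. G e) = (\<Sum>i\<in>UNIV. \<Sum>j | {i, j} \<in> E. (F i j :: real))"
proof -
  let ?P = "SIGMA i:UNIV. {j. {i, j} \<in> E}" and ?h = "\<lambda>(i, j). {i, j}"
  have "(\<Sum>i\<in>UNIV. \<Sum>j | {i, j} \<in> E. F i j) = (\<Sum>(i, j)\<in>?P. F i j)"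
    by (rule sum.Sigma) auto
  also have "\<dots> = (\<Sum>e\<in>E. \<Sum>p | p \<in> ?P \<and> ?h p = e. (\<lambda>(i, j). F i j) p)"
    by (rule sum.group [symmetric]) auto
  also have "\<dots> = (\<Sum>e\<in>E. G e)"
  proof (rule sum.cong [OF refl])
    fix e assume e: "e \<in> E"
    then obtain i j where ij: "e = {i, j}" "i \<noteq> j"
      using assms(1) by (auto simp: simple_graph_def card_2_iff)
    then have "{p. p \<in> ?P \<and> ?h p = e} = {(i, j), (j, i)}"
      using e by (auto simp: doubleton_eq_iff insert_commute)
    then show "(\<Sum>p | p \<in> ?P \<and> ?h p = e. (\<lambda>(i, j). F i j) p) = G e"
      using ij e G [of i j] by simp
  qed
  finally show ?thesis by simp
qed

lemma Sgn_mult: "z \<in> Sgn t \<Longrightarrow> z * t = \<bar>t\<bar>"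
  by (auto simp: Sgn_def split: if_splits)

text \<open>One choice of signs \<open>z\<close> serves every rescaling \<open>a\<close>: on an edge
  with two nonzero ends \<open>\<bar>a i\<bar>\<close> factors out, and an edge with a zero end
  involves the factor of the other end only.\<close>

lemma I_plus_rescaled_eigenvector:
  fixes E :: "'n::finite set set" and x :: "real^'n" and a :: "'n \<Rightarrow> real"
  assumes E: "simple_graph E" and x: "eigenpair E lam x"
    and a: "\<And>i j. {i, j} \<in> E \<Longrightarrow> x $ i \<noteq> 0 \<Longrightarrow> x $ j \<noteq> 0 \<Longrightarrow> a i = a j"
  shows "I_plus E (\<chi> i. a i * x $ i) = lam * degree_norm E (\<chi> i. a i * x $ i)"
proof -
  obtain z v where z: "\<And>i j. {i, j} \<in> E \<Longrightarrow> z i j \<in> Sgn (x $ i + x $ j) \<and> z i j = z j i"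
    and v: "v \<in> Sgn_vec x"
    and zv: "\<And>i. (\<Sum>j | {i, j} \<in> E. z i j) = lam * real (degree E i) * v $ i"
  proof -
    obtain y v where "y \<in> signless_Laplacian E x" "v \<in> Sgn_vec x"
      "y = (\<chi> i. lam * real (degree E i) * v $ i)"
      using x by (auto simp: eigenpair_def)
    moreover then obtain z where "\<And>i j. {i, j} \<in> E \<Longrightarrow> z i j \<in> Sgn (x $ i + x $ j) \<and> z i j = z j i"
      "y = (\<chi> i. \<Sum>j | {i, j} \<in> E. z i j)"
      unfolding signless_Laplacian_def by blast
    ultimately show thesis by (intro that [of z v]) (blast, simp_all add: vec_eq_iff)
  qed
  have "I_plus E (\<chi> i. a i * x $ i) = (\<Sum>i\<in>UNIV. \<Sum>j | {i, j} \<in> E. z i j * (\<bar>a i\<bar> * x $ i))"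
    unfolding I_plus_def
  proof (rule sum_edges [OF E])
    fix i j assume ij: "{i, j} \<in> E"
    then have "i \<noteq> j" using E by (auto simp: simple_graph_def)
    have z1: "z i j * (x $ i + x $ j) = \<bar>x $ i + x $ j\<bar>" and z2: "z j i = z i j"
      using z [OF ij] Sgn_mult by auto
    have "\<bar>a i * x $ i + a j * x $ j\<bar> = z i j * (\<bar>a i\<bar> * x $ i + \<bar>a j\<bar> * x $ j)"
    proof -
      consider "x $ i = 0" | "x $ j = 0" | "a i = a j" using a [OF ij] by blast
      then show ?thesis
      proof cases
        case 1 then show ?thesis using z1 by (simp add: abs_mult)
      next
        case 2 then show ?thesis using z1 by (simp add: abs_mult)
      next
        case 3
        have "\<bar>a j * x $ i + a j * x $ j\<bar> = \<bar>a j\<bar> * \<bar>x $ i + x $ j\<bar>"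
          by (simp add: abs_mult flip: distrib_left)
        then show ?thesis unfolding 3 z1 [symmetric] by (simp add: algebra_simps)
      qed
    qed
    then show "\<bar>\<Sum>l\<in>{i, j}. (\<chi> i. a i * x $ i) $ l\<bar> = z i j * (\<bar>a i\<bar> * x $ i) + z j i * (\<bar>a j\<bar> * x $ j)"
      using \<open>i \<noteq> j\<close> by (simp add: z2 algebra_simps)
  qed
  \<comment> \<open>At each vertex this is the eigenvalue equation multiplied by
    \<open>\<bar>a i\<bar> * x $ i\<close>, with
    \<open>v $ i * x $ i = \<bar>x $ i\<bar>\<close>.\<close>
  also have "\<dots> = (\<Sum>i\<in>UNIV. lam * (real (degree E i) * \<bar>a i * x $ i\<bar>))"
  proof (rule sum.cong [OF refl])
    fix i
    have "v $ i * x $ i = \<bar>x $ i\<bar>" using v by (auto simp: Sgn_vec_def intro: Sgn_mult)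
    moreover have "(\<Sum>j | {i, j} \<in> E. z i j * (\<bar>a i\<bar> * x $ i)) = lam * real (degree E i) * \<bar>a i\<bar> * (v $ i * x $ i)"
      by (simp add: zv flip: sum_distrib_right)
    ultimately show "(\<Sum>j | {i, j} \<in> E. z i j * (\<bar>a i\<bar> * x $ i)) = lam * (real (degree E i) * \<bar>a i * x $ i\<bar>)"
      by (simp add: abs_mult)
  qed
  finally show ?thesis by (simp add: degree_norm_def sum_distrib_left)
qed

text \<open>The closure is reflexive on the whole type, so vertices outside \<open>D\<close> form
  singleton classes; the quotient of \<open>D\<close> leaves these out.\<close>

lemma equiv_induced: "equiv UNIV ((induced_adj E D)\<^sup>*)"
proof -
  have "sym (induced_adj E D)" by (auto simp: sym_def induced_adj_def insert_commute)
  then show ?thesis by (simp add: equiv_def refl_rtrancl sym_rtrancl trans_rtrancl)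
qed

lemma induced_rtrancl_subset: "(i, j) \<in> (induced_adj E D)\<^sup>* \<Longrightarrow> i \<in> D \<Longrightarrow> j \<in> D"
  by (induction rule: rtrancl_induct) (auto simp: induced_adj_def)

lemma minmax_value_card_nodal_domains_le:
  fixes E :: "'n::finite set set" and x :: "real^'n"
  assumes E: "simple_graph E" "no_isolated_vertices E" and x: "eigenpair E lam x"
    and m: "1 \<le> card (nodal_domains E x)"
  shows "minmax_value E (card (nodal_domains E x)) \<le> lam"
proof -
  define D where "D = {i. x $ i \<noteq> 0}"
  define c where "c i = (induced_adj E D)\<^sup>* `` {i}" for i
  define s :: "'n set \<Rightarrow> 'n" where "s C = (SOME i. i \<in> C)" for C
  have nd: "nodal_domains E x = c ` D"
    unfolding nodal_domains_def components_of_induced_def D_def [symmetric]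
    by (auto simp: quotient_def c_def)
  have c_eq: "c j = c i" if "j \<in> c i" for i j
    using that equiv_class_eq [OF equiv_induced, of i j E D] by (simp add: c_def)
  have s_in: "s (c i) \<in> c i" for i
    unfolding s_def by (rule someI [of _ i]) (simp add: c_def)
  have c_s: "c (s (c i)) = c i" for i by (rule c_eq [OF s_in])
  have s_D: "s (c i) \<in> D" if "i \<in> D" for i
    using s_in [of i] induced_rtrancl_subset that by (auto simp: c_def)
  define P where "P = s ` c ` D"
  have "inj_on s (c ` D)"
    by (rule inj_on_inverseI [of _ c]) (auto simp: c_s)
  then have card_P: "card P = card (nodal_domains E x)" by (simp add: P_def nd card_image)
  \<comment> \<open>A vector in \<open>T\<close> has one free coordinate for each nodal domain, at its representative; \<open>H\<close> spreads
    this coordinate over the whole domain.\<close>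
  define T :: "(real^'n) set" where "T = {u. \<forall>i. i \<notin> P \<longrightarrow> u $ i = 0}"
  have T: "subspace T" by (auto simp: T_def subspace_def)
  have dim_T: "dim T = card (nodal_domains E x)"
  proof -
    let ?B = "(\<lambda>i. axis i (1::real)) ` P :: (real^'n) set"
    have "T = {u. \<forall>e\<in>Basis. e \<notin> ?B \<longrightarrow> u \<bullet> e = 0}"
      by (auto simp: T_def Basis_vec_def image_iff axis_eq_axis inner_axis)
    moreover have "card ?B = card P" by (rule card_image) (auto simp: inj_on_def axis_eq_axis)
    moreover have "?B \<subseteq> Basis" by (auto simp: Basis_vec_def)
    ultimately show ?thesis using dim_substandard [of ?B] card_P by simp
  qed
  define H :: "real^'n \<Rightarrow> real^'n" where "H u = (\<chi> i. u $ s (c i) * x $ i)" for u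
  \<comment> \<open>A nonzero coordinate of \<open>u\<close> sits at a representative
    \<open>i\<close>, where \<open>s (c i) = i\<close> and \<open>x $ i \<noteq> 0\<close>, so
    \<open>H u\<close> is nonzero there.\<close>
  have "H u \<noteq> 0" if u: "u \<in> sphere 0 1 \<inter> T" for u
  proof
    assume "H u = 0"
    have "u \<noteq> 0" using u by auto
    then obtain i where i: "u $ i \<noteq> 0" by (auto simp: vec_eq_iff)
    then have "i \<in> P" using u by (auto simp: T_def)
    then obtain j where j: "j \<in> D" "i = s (c j)" by (auto simp: P_def)
    then have "i \<in> D" "s (c i) = i" using s_D c_s by simp_all
    moreover have "u $ s (c i) * x $ i = 0" using \<open>H u = 0\<close> by (simp add: H_def vec_eq_iff)
    ultimately show False using i by (simp add: D_def)
  qed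
  moreover have "continuous_on (sphere 0 1 \<inter> T) H"
    unfolding H_def by (intro continuous_intros)
  moreover have "H (- u) = - H u" for u by (simp add: H_def vec_eq_iff)
  ultimately have adm: "admissible E (dim T) ((\<lambda>u. H u /\<^sub>R degree_norm E (H u)) ` (sphere 0 1 \<inter> T))"
    (is "admissible E _ ?A") by (intro admissible_image [OF E(2) T])
  have "I_plus E y \<le> lam" if y: "y \<in> ?A" for y
  proof -
    obtain u where "y = H u /\<^sub>R degree_norm E (H u)" using y by blast
    \<comment> \<open>The normalizing factor is absorbed into the multiplier, which remains constant
      on each nodal domain.\<close>
    then have yu: "y = (\<chi> i. (u $ s (c i) / degree_norm E (H u)) * x $ i)"
      by (simp add: H_def vec_eq_iff divide_inverse_commute)
    have "I_plus E y = lam * degree_norm E y"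
      unfolding yu
    proof (rule I_plus_rescaled_eigenvector [OF E(1) x])
      fix i j assume "{i, j} \<in> E" "x $ i \<noteq> 0" "x $ j \<noteq> 0"
      then have "j \<in> c i" by (auto simp: c_def induced_adj_def D_def)
      then show "u $ s (c i) / degree_norm E (H u) = u $ s (c j) / degree_norm E (H u)"
        by (simp add: c_eq)
    qed
    moreover have "degree_norm E y = 1"
      using y admissibleD(1) [OF adm] by (auto simp: X_sphere_degree_norm)
    ultimately show ?thesis by simp
  qed
  then show ?thesis using minmax_value_le [OF adm] m by (simp add: dim_T)
qed

theorem theorem3p3:
  fixes E :: "'n::finite set set" and x :: "real^'n" and k r :: nat
  assumes "simple_graph E"
    and "no_isolated_vertices E"
    and "1 \<le> k" and "k \<le> CARD('n)"
    and "eigenpair E (minmax_value E k) x"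
    and "r = card {j \<in> {1..CARD('n)}. minmax_value E j = minmax_value E k}"
  shows "1 \<le> card (nodal_domains E x) \<and> card (nodal_domains E x) \<le> k + r - 1"
proof
  let ?m = "card (nodal_domains E x)"
  have nd: "nodal_domains E x
      = (\<lambda>i. (induced_adj E {i. x $ i \<noteq> 0})\<^sup>* `` {i}) ` {i. x $ i \<noteq> 0}"
    by (auto simp: nodal_domains_def components_of_induced_def quotient_def)
  have "x \<noteq> 0" using assms(5) by (simp add: eigenpair_def)
  then have "{i. x $ i \<noteq> 0} \<noteq> {}" by (auto simp: vec_eq_iff)
  then show m1: "1 \<le> ?m" by (simp add: nd Suc_le_eq card_gt_0_iff)
  show "?m \<le> k + r - 1"
  proof (rule ccontr)
    assume "\<not> ?m \<le> k + r - 1"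
    \<comment> \<open>Since \<open>1 \<le> k\<close>, the natural-number subtraction does not
      truncate.\<close>
    then have m: "k + r \<le> ?m" using assms(3) by simp
    have "?m \<le> card {i. x $ i \<noteq> 0}" unfolding nd by (rule card_image_le) simp
    also have "\<dots> \<le> CARD('n)" by (rule card_mono) auto
    finally have mn: "?m \<le> CARD('n)" .
    have le: "minmax_value E ?m \<le> minmax_value E k"
      by (rule minmax_value_card_nodal_domains_le [OF assms(1,2,5) m1])
    \<comment> \<open>Monotonicity and \<open>le\<close> squeeze all values from index
      \<open>k\<close> to \<open>?m\<close> together; these are at least \<open>r + 1\<close>
      indices.\<close>
    have "{k..?m} \<subseteq> {j \<in> {1..CARD('n)}. minmax_value E j = minmax_value E k}"
    proof
      fix j assume j: "j \<in> {k..?m}"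
      then have "minmax_value E k \<le> minmax_value E j" "minmax_value E j \<le> minmax_value E ?m"
        using minmax_value_mono [OF assms(2)] assms(3) mn by simp_all
      then have "minmax_value E j = minmax_value E k" using le by simp
      then show "j \<in> {j \<in> {1..CARD('n)}. minmax_value E j = minmax_value E k}"
        using j mn assms(3) by simp
    qed
    then have "card {k..?m} \<le> r" unfolding assms(6) by (rule card_mono [rotated]) simp
    then show False using m by simp
  qed
qed

end
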